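(* Let $n\ge2$, $M\ge1$, $u_1,\dots,u_M\in[n-1]$ (repetitions allowed), and let $W=\frac1M\sum_{i=1}^M A^{(u_i)}$ (a D-EquiStatic matrix) have consensus rate $\rho$. Let $\widetilde W=\frac12(W+W^T)=\frac1{2M}\sum_{i=1}^M\big(A^{(u_i)}+[A^{(u_i)}]^T\big)$ (the U-EquiStatic matrix). Then $$\|\Pi\widetilde W x\|\le\rho\,\|\Pi x\|\qquad\text{for all }x\in\mathbb{R}^n .$$
   Context: Notation: $[m]=\{1,\dots,m\}$; $\|\cdot\|$ is the Euclidean norm; $\mathbf 1_n$ is the all-ones vector; $J=\frac1n\mathbf 1_n\mathbf 1_n^T$ and $\Pi=I-J$. The operation $i\bmod n$ returns the representative of $i$ modulo $n$ lying in $\{1,\dots,n\}$. Basis matrices: for $u\in[n-1]$, $A^{(u)}=[a^{(u)}_{ij}]\in\mathbb{R}^{n\times n}$ is defined by $a^{(u)}_{ij}=\frac{n-1}{n}$ if $i=(j+u)\bmod n$, $a^{(u)}_{ij}=\frac1n$ if $i=j$, and $a^{(u)}_{ij}=0$ otherwise. Consensus rate: the consensus rate of a fixed matrix $W$ is the minimum $\rho\ge0$ such that $\|\Pi Wx\|\le\rho\|\Pi x\|$ for all $x\in\mathbb{R}^n$. *)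

theory Defs
  imports "Jordan_Normal_Form.Matrix" "HOL-Analysis.L2_Norm"
begin

definition euclid_norm :: "real vec \<Rightarrow> real" where
  "euclid_norm v = L2_set (\<lambda>i. v $ i) {0..<dim_vec v}"

text \<open>The representative of \<^term>\<open>i\<close> modulo \<^term>\<open>n\<close> in \<open>{1..n}\<close>.\<close>

definition rep_mod :: "nat \<Rightarrow> nat \<Rightarrow> nat" where
  "rep_mod i n = (if i mod n = 0 then n else i mod n)"

definition ones_col :: "nat \<Rightarrow> real mat" where
  "ones_col n = mat n 1 (\<lambda>_. 1)"

definition avg_mat :: "nat \<Rightarrow> real mat" where
  "avg_mat n = (1 / real n) \<cdot>\<^sub>m (ones_col n * transpose_mat (ones_col n))"

definition center_mat :: "nat \<Rightarrow> real mat" where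
  "center_mat n = 1\<^sub>m n - avg_mat n"

text \<open>Indices of library matrices start at \<open>0\<close>, so the entry \<open>(i, j)\<close> of the
  mathematical matrix, with \<open>i, j \<in> {1..n}\<close>, is stored at position
  \<open>(i - 1, j - 1)\<close>.\<close>

definition basis_entry :: "nat \<Rightarrow> nat \<Rightarrow> nat \<Rightarrow> nat \<Rightarrow> real" where
  "basis_entry n u i j =
     (if i = rep_mod (j + u) n then (real n - 1) / real n
      else if i = j then 1 / real n
      else 0)"

definition basis_mat :: "nat \<Rightarrow> nat \<Rightarrow> real mat" where
  "basis_mat n u = mat n n (\<lambda>(k, l). basis_entry n u (Suc k) (Suc l))"

definition sum_mats :: "nat \<Rightarrow> ('i \<Rightarrow> real mat) \<Rightarrow> 'i set \<Rightarrow> real mat" where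
  "sum_mats n F I = mat n n (\<lambda>(k, l). \<Sum>i\<in>I. F i $$ (k, l))"

definition d_equistatic :: "nat \<Rightarrow> nat \<Rightarrow> (nat \<Rightarrow> nat) \<Rightarrow> real mat" where
  "d_equistatic n M u = (1 / real M) \<cdot>\<^sub>m sum_mats n (\<lambda>i. basis_mat n (u i)) {1..M}"

definition u_equistatic :: "nat \<Rightarrow> nat \<Rightarrow> (nat \<Rightarrow> nat) \<Rightarrow> real mat" where
  "u_equistatic n M u =
     (1 / 2) \<cdot>\<^sub>m (d_equistatic n M u + transpose_mat (d_equistatic n M u))"

definition is_consensus_bound :: "nat \<Rightarrow> real mat \<Rightarrow> real \<Rightarrow> bool" where
  "is_consensus_bound n W r \<longleftrightarrow>
     0 \<le> r \<and>
     (\<forall>x\<in>carrier_vec n.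
        euclid_norm (center_mat n *\<^sub>v (W *\<^sub>v x)) \<le> r * euclid_norm (center_mat n *\<^sub>v x))"

text \<open>The minimum need not exist for an arbitrary matrix; it does for the matrices
  considered here, see \<open>d_equistatic_consensus_rate\<close> below.\<close>

definition consensus_rate :: "nat \<Rightarrow> real mat \<Rightarrow> real" where
  "consensus_rate n W = (LEAST r. is_consensus_bound n W r)"

lemma u_equistatic_alt:
  "u_equistatic n M u =
     (1 / (2 * real M)) \<cdot>\<^sub>m
       sum_mats n (\<lambda>i. basis_mat n (u i) + transpose_mat (basis_mat n (u i))) {1..M}"
  by (rule eq_matI)
    (auto simp: u_equistatic_def d_equistatic_def sum_mats_def basis_mat_def
      sum.distrib add_divide_distrib)

lemma consensus_rate_minimum:
  assumes "is_consensus_bound n W r0"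
  shows "is_consensus_bound n W (consensus_rate n W)"
    and "is_consensus_bound n W r \<Longrightarrow> consensus_rate n W \<le> r"
proof -
  define S where "S = {r. is_consensus_bound n W r}"
  have ne: "S \<noteq> {}" and bdd: "bdd_below S"
    using assms by (auto simp: S_def is_consensus_bound_def intro!: bdd_belowI[of _ 0])
  have Inf: "is_consensus_bound n W (Inf S)"
    unfolding is_consensus_bound_def
  proof (intro conjI ballI)
    show "0 \<le> Inf S"
      using ne by (intro cInf_greatest) (auto simp: S_def is_consensus_bound_def)
  next
    fix x :: "real vec" assume x: "x \<in> carrier_vec n"
    let ?a = "euclid_norm (center_mat n *\<^sub>v (W *\<^sub>v x))"
    let ?b = "euclid_norm (center_mat n *\<^sub>v x)"
    have S: "?a \<le> r * ?b" if "r \<in> S" for r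
      using that x by (auto simp: S_def is_consensus_bound_def)
    have b: "0 \<le> ?b"
      by (simp add: euclid_norm_def)
    show "?a \<le> Inf S * ?b"
    proof (cases "?b = 0")
      case True
      with S ne show ?thesis by auto
    next
      case False
      with b have "0 < ?b" by simp
      then have "?a / ?b \<le> Inf S"
        using ne S by (intro cInf_greatest) (auto simp: divide_le_eq)
      with \<open>0 < ?b\<close> show ?thesis by (simp add: divide_le_eq)
    qed
  qed
  have least: "consensus_rate n W = Inf S"
    unfolding consensus_rate_def
    by (rule Least_equality) (use Inf bdd in \<open>auto simp: S_def intro: cInf_lower\<close>)
  show "is_consensus_bound n W (consensus_rate n W)"
    using Inf least by simp
  show "consensus_rate n W \<le> r" if "is_consensus_bound n W r"
    using that least bdd by (auto simp: S_def intro: cInf_lower)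
qed

lemma basis_mat_row_sum:
  assumes "2 \<le> n" "u \<in> {1..n - 1}" "k < n"
  shows "(\<Sum>l<n. basis_mat n u $$ (k, l)) = 1"
proof -
  define l0 where "l0 = (if u \<le> k then k - u else k + n - u)"
  have l0: "l0 < n" "l0 \<noteq> k"
    using assms by (auto simp: l0_def)
  have iff: "Suc k = rep_mod (Suc l + u) n \<longleftrightarrow> l = l0" if "l < n" for l
  proof (cases "Suc l + u < n")
    case True
    then show ?thesis using assms that by (auto simp: rep_mod_def l0_def)
  next
    case False
    moreover have "Suc l + u - n < n"
      using assms that by auto
    ultimately have "(Suc l + u) mod n = Suc l + u - n"
      by (metis le_mod_geq mod_less not_less)
    then show ?thesis using False assms that by (auto simp: rep_mod_def l0_def)
  qed
  have "(\<Sum>l<n. basis_mat n u $$ (k, l))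
      = (\<Sum>l<n. (if l = l0 then (real n - 1) / real n else 0) + (if l = k then 1 / real n else 0))"
    using assms l0 iff by (intro sum.cong) (auto simp: basis_mat_def basis_entry_def)
  also have "\<dots> = (real n - 1) / real n + 1 / real n"
    using assms l0 by (simp add: sum.distrib)
  also have "\<dots> = 1"
    using assms by (simp add: field_simps)
  finally show ?thesis .
qed

lemma d_equistatic_row_sum:
  assumes "2 \<le> n" "1 \<le> M" "\<forall>i\<in>{1..M}. u i \<in> {1..n - 1}" "k < n"
  shows "(\<Sum>l<n. d_equistatic n M u $$ (k, l)) = 1"
proof -
  have "(\<Sum>l<n. d_equistatic n M u $$ (k, l))
      = (1 / real M) * (\<Sum>l<n. \<Sum>i=1..M. basis_mat n (u i) $$ (k, l))"
    using assms by (simp add: d_equistatic_def sum_mats_def sum_distrib_left)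
  also have "\<dots> = (1 / real M) * (\<Sum>i=1..M. \<Sum>l<n. basis_mat n (u i) $$ (k, l))"
    by (subst sum.swap) simp
  also have "\<dots> = 1"
    using assms by (simp add: basis_mat_row_sum del: One_nat_def)
  finally show ?thesis .
qed

lemma center_mat_carrier [simp]: "center_mat n \<in> carrier_mat n n"
  by (rule carrier_matI) (simp_all add: center_mat_def avg_mat_def ones_col_def)

lemma dim_center_mat [simp]: "dim_row (center_mat n) = n" "dim_col (center_mat n) = n"
  using center_mat_carrier[of n] by (auto simp only: carrier_matD)

lemma center_mat_mult_vec:
  assumes "x \<in> carrier_vec n" "k < n"
  shows "(center_mat n *\<^sub>v x) $ k = x $ k - (\<Sum>l<n. x $ l) / real n"
proof -
  have "(center_mat n *\<^sub>v x) $ k = (\<Sum>l<n. center_mat n $$ (k, l) * x $ l)"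
    using assms
    by (auto simp: scalar_prod_def atLeast0LessThan intro!: sum.cong)
  also have "\<dots> = (\<Sum>l<n. (if l = k then x $ l else 0) - x $ l / real n)"
    using assms
    by (intro sum.cong)
      (auto simp: center_mat_def avg_mat_def ones_col_def scalar_prod_def algebra_simps)
  also have "\<dots> = x $ k - (\<Sum>l<n. x $ l) / real n"
    using assms by (simp add: sum_subtractf sum_divide_distrib)
  finally show ?thesis .
qed

lemma mult_vec_bounded:
  assumes "A \<in> carrier_mat n n" "y \<in> carrier_vec n"
  shows "euclid_norm (A *\<^sub>v y) \<le> (\<Sum>k<n. \<Sum>l<n. \<bar>A $$ (k, l)\<bar>) * euclid_norm y"
proof -
  have y: "\<bar>y $ l\<bar> \<le> euclid_norm y" if "l < n" for l
    using that assms member_le_L2_set[of "{0..<n}" l "\<lambda>i. \<bar>y $ i\<bar>"]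
    by (simp add: euclid_norm_def L2_set_def)
  have "euclid_norm (A *\<^sub>v y) \<le> (\<Sum>k<n. \<bar>(A *\<^sub>v y) $ k\<bar>)"
    using assms L2_set_le_sum_abs[of "\<lambda>k. (A *\<^sub>v y) $ k" "{0..<n}"]
    by (simp add: euclid_norm_def atLeast0LessThan)
  also have "\<dots> \<le> (\<Sum>k<n. \<Sum>l<n. \<bar>A $$ (k, l)\<bar> * euclid_norm y)"
  proof (rule sum_mono)
    fix k assume "k \<in> {..<n}"
    then have "(A *\<^sub>v y) $ k = (\<Sum>l<n. A $$ (k, l) * y $ l)"
      using assms by (auto simp: scalar_prod_def atLeast0LessThan intro!: sum.cong)
    then have "\<bar>(A *\<^sub>v y) $ k\<bar> \<le> (\<Sum>l<n. \<bar>A $$ (k, l) * y $ l\<bar>)"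
      by (simp only: sum_abs)
    also have "\<dots> \<le> (\<Sum>l<n. \<bar>A $$ (k, l)\<bar> * euclid_norm y)"
      using y by (intro sum_mono) (auto simp: abs_mult intro!: mult_left_mono)
    finally show "\<bar>(A *\<^sub>v y) $ k\<bar> \<le> (\<Sum>l<n. \<bar>A $$ (k, l)\<bar> * euclid_norm y)" .
  qed
  finally show ?thesis
    by (simp add: sum_distrib_right)
qed

lemma d_equistatic_carrier [simp]: "d_equistatic n M u \<in> carrier_mat n n"
  by (simp add: d_equistatic_def sum_mats_def)

lemma d_equistatic_consensus_bound_exists:
  assumes "2 \<le> n" "1 \<le> M" "\<forall>i\<in>{1..M}. u i \<in> {1..n - 1}"
  shows "\<exists>r. is_consensus_bound n (d_equistatic n M u) r"
proof -
  define W where "W = d_equistatic n M u"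
  have W: "W \<in> carrier_mat n n"
    by (simp add: W_def)
  define A where "A = center_mat n * W"
  have A: "A \<in> carrier_mat n n"
    unfolding A_def by (rule mult_carrier_mat[OF center_mat_carrier W])
  have entry: "(W *\<^sub>v z) $ k = (\<Sum>l<n. W $$ (k, l) * z $ l)"
    if "z \<in> carrier_vec n" "k < n" for z k
    using that W by (auto simp: scalar_prod_def atLeast0LessThan intro!: sum.cong)
  have eq: "center_mat n *\<^sub>v (W *\<^sub>v x) = A *\<^sub>v (center_mat n *\<^sub>v x)"
    if x: "x \<in> carrier_vec n" for x
  proof -
    define c where "c = (\<Sum>l<n. x $ l) / real n"
    have cx: "center_mat n *\<^sub>v x \<in> carrier_vec n" for x :: "real vec"
      by (rule carrier_vecI) simp
    have Wz: "(W *\<^sub>v (center_mat n *\<^sub>v x)) $ k = (W *\<^sub>v x) $ k - c" if k: "k < n" for k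
    proof -
      have "(W *\<^sub>v (center_mat n *\<^sub>v x)) $ k = (\<Sum>l<n. W $$ (k, l) * (x $ l - c))"
        using x k cx by (auto simp: entry center_mat_mult_vec c_def simp del: index_mult_mat_vec)
      also have "\<dots> = (\<Sum>l<n. W $$ (k, l) * x $ l) - (\<Sum>l<n. W $$ (k, l)) * c"
        by (simp add: algebra_simps sum_subtractf sum_distrib_left)
      also have "\<dots> = (W *\<^sub>v x) $ k - c"
        using d_equistatic_row_sum[OF assms k] x k by (simp add: entry W_def[symmetric] del: index_mult_mat_vec)
      finally show ?thesis .
    qed
    have "center_mat n *\<^sub>v (W *\<^sub>v (center_mat n *\<^sub>v x)) = center_mat n *\<^sub>v (W *\<^sub>v x)"
    proof (rule eq_vecI)
      fix k assume "k < dim_vec (center_mat n *\<^sub>v (W *\<^sub>v x))"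
      then have k: "k < n" by simp
      have "(\<Sum>l<n. (W *\<^sub>v (center_mat n *\<^sub>v x)) $ l) = (\<Sum>l<n. (W *\<^sub>v x) $ l) - real n * c"
        using Wz by (simp add: sum_subtractf del: index_mult_mat_vec)
      moreover have "W *\<^sub>v z \<in> carrier_vec n" for z
        using W by (intro carrier_vecI) auto
      ultimately show "(center_mat n *\<^sub>v (W *\<^sub>v (center_mat n *\<^sub>v x))) $ k
          = (center_mat n *\<^sub>v (W *\<^sub>v x)) $ k"
        using k Wz assms(1)
        by (simp add: center_mat_mult_vec diff_divide_distrib del: index_mult_mat_vec)
    qed simp
    then show ?thesis
      using assoc_mult_mat_vec[OF center_mat_carrier W cx] by (simp add: A_def)
  qed
  have "is_consensus_bound n W (\<Sum>k<n. \<Sum>l<n. \<bar>A $$ (k, l)\<bar>)"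
    unfolding is_consensus_bound_def
  proof (intro conjI ballI)
    fix x :: "real vec" assume x: "x \<in> carrier_vec n"
    have "center_mat n *\<^sub>v x \<in> carrier_vec n"
      by (rule carrier_vecI) simp
    then show "euclid_norm (center_mat n *\<^sub>v (W *\<^sub>v x))
        \<le> (\<Sum>k<n. \<Sum>l<n. \<bar>A $$ (k, l)\<bar>) * euclid_norm (center_mat n *\<^sub>v x)"
      using mult_vec_bounded[OF A] eq[OF x] by simp
  qed (auto intro!: sum_nonneg)
  then show ?thesis
    unfolding W_def by blast
qed

lemma d_equistatic_consensus_rate:
  assumes "2 \<le> n" "1 \<le> M" "\<forall>i\<in>{1..M}. u i \<in> {1..n - 1}"
  shows "is_consensus_bound n (d_equistatic n M u) (consensus_rate n (d_equistatic n M u))"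
    and "is_consensus_bound n (d_equistatic n M u) r
      \<Longrightarrow> consensus_rate n (d_equistatic n M u) \<le> r"
  using d_equistatic_consensus_bound_exists[OF assms] consensus_rate_minimum by blast+

end

(* Reversing the order of the coordinates turns a Toeplitz matrix into its transpose.  It also
   preserves the Euclidean norm and commutes with centering, so W and its transpose satisfy the
   same consensus bounds, and the triangle inequality passes them on to the average of the two. *)

theory Submission
  imports Defs
begin

text \<open>This is the action of the exchange matrix J (ones on the antidiagonal). As a reindexing
  it lets sums over the entries be handled by permuting indices. With indices from 0, the mirror
  image of \<open>i\<close> is \<open>dim_vec v - Suc i\<close>.\<close>

definition reverse_vec :: "'a vec \<Rightarrow> 'a vec" where
  "reverse_vec v = vec (dim_vec v) (\<lambda>i. v $ (dim_vec v - Suc i))"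

lemma dim_reverse_vec [simp]: "dim_vec (reverse_vec v) = dim_vec v"
  by (simp add: reverse_vec_def)

lemma reverse_vec_carrier [simp]: "reverse_vec v \<in> carrier_vec n \<longleftrightarrow> v \<in> carrier_vec n"
  by (auto intro: carrier_vecI dest: carrier_vecD)

lemma reverse_vec_index [simp]:
  "i < dim_vec v \<Longrightarrow> reverse_vec v $ i = v $ (dim_vec v - Suc i)"
  by (simp add: reverse_vec_def)

lemma sum_reverse_vec:
  "(\<Sum>i<dim_vec v. f (reverse_vec v $ i)) = (\<Sum>i<dim_vec v. f (v $ i))"
proof -
  have "(\<Sum>i<dim_vec v. f (reverse_vec v $ i)) = (\<Sum>i<dim_vec v. f (v $ (dim_vec v - Suc i)))"
    by (intro sum.cong) auto
  also have "\<dots> = (\<Sum>i<dim_vec v. f (v $ i))"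
    by (rule sum.nat_diff_reindex)
  finally show ?thesis .
qed

lemma euclid_norm_reverse_vec: "euclid_norm (reverse_vec v) = euclid_norm v"
  unfolding euclid_norm_def L2_set_def atLeast0LessThan dim_reverse_vec
  by (simp only: sum_reverse_vec[of "\<lambda>x. x\<^sup>2"])

text \<open>Centering subtracts the mean from every entry, and the mean does not depend on the order
  of the entries.\<close>

lemma center_mat_reverse_vec:
  assumes "x \<in> carrier_vec n"
  shows "center_mat n *\<^sub>v reverse_vec x = reverse_vec (center_mat n *\<^sub>v x)"
proof (rule eq_vecI)
  fix k assume "k < dim_vec (reverse_vec (center_mat n *\<^sub>v x))"
  then show "(center_mat n *\<^sub>v reverse_vec x) $ k = reverse_vec (center_mat n *\<^sub>v x) $ k"
    using assms sum_reverse_vec[of "\<lambda>x. x" x]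
    by (simp add: center_mat_mult_vec carrier_vecD del: index_mult_mat_vec)
qed simp

text \<open>Symmetry about the antidiagonal, that is, J A J equals the transpose of A for the
  exchange matrix J. Toeplitz matrices have it, and it is the only consequence of the Toeplitz form
  that the argument needs.\<close>

definition persymmetric :: "nat \<Rightarrow> 'a mat \<Rightarrow> bool" where
  "persymmetric n A \<longleftrightarrow> (\<forall>k<n. \<forall>l<n. A $$ (n - Suc k, n - Suc l) = A $$ (l, k))"

lemma transpose_mult_vec_persymmetric:
  fixes A :: "'a :: comm_semiring_0 mat"
  assumes A: "A \<in> carrier_mat n n" "persymmetric n A" and x: "x \<in> carrier_vec n"
  shows "transpose_mat A *\<^sub>v x = reverse_vec (A *\<^sub>v reverse_vec x)"
proof (rule eq_vecI)
  fix k assume "k < dim_vec (reverse_vec (A *\<^sub>v reverse_vec x))"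
  then have k: "k < n" using A by simp
  have "(transpose_mat A *\<^sub>v x) $ k = (\<Sum>l<n. A $$ (l, k) * x $ l)"
    using A x k by (auto simp: scalar_prod_def atLeast0LessThan intro!: sum.cong)
  \<comment> \<open>Mirroring the summation index puts the reversed entries of \<open>x\<close> in
    place; persymmetry then moves the entry of \<open>A\<close> into row
    \<open>n - Suc k\<close>.\<close>
  also have "\<dots> = (\<Sum>l<n. A $$ (n - Suc l, k) * x $ (n - Suc l))"
    by (rule sum.nat_diff_reindex[symmetric])
  also have "\<dots> = (\<Sum>l<n. A $$ (n - Suc k, l) * x $ (n - Suc l))"
  proof (intro sum.cong refl)
    fix l assume l: "l \<in> {..<n}"
    then have "n - Suc l < n"
      by simp
    \<comment> \<open>Persymmetry is used at the column index \<open>n - Suc l\<close>, whose mirror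
      image is \<open>l\<close> again because \<open>l < n\<close>.\<close>
    with A(2) k have "A $$ (n - Suc k, n - Suc (n - Suc l)) = A $$ (n - Suc l, k)"
      unfolding persymmetric_def by blast
    then show "A $$ (n - Suc l, k) * x $ (n - Suc l) = A $$ (n - Suc k, l) * x $ (n - Suc l)"
      using l by simp
  qed
  also have "\<dots> = reverse_vec (A *\<^sub>v reverse_vec x) $ k"
    using A x k by (auto simp: scalar_prod_def atLeast0LessThan intro!: sum.cong)
  finally show "(transpose_mat A *\<^sub>v x) $ k = reverse_vec (A *\<^sub>v reverse_vec x) $ k" .
qed (use A x in auto)

text \<open>The bound for the transpose at \<open>x\<close> is the bound for \<open>A\<close> at
  \<open>reverse_vec x\<close>: on both sides the reversal passes through the centering and
  disappears in the norm.\<close>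

lemma is_consensus_bound_transpose:
  assumes A: "A \<in> carrier_mat n n" "persymmetric n A" and r: "is_consensus_bound n A r"
  shows "is_consensus_bound n (transpose_mat A) r"
  unfolding is_consensus_bound_def
proof (intro conjI ballI)
  show "0 \<le> r"
    using r by (simp add: is_consensus_bound_def)
  fix x :: "real vec" assume x: "x \<in> carrier_vec n"
  then have "euclid_norm (center_mat n *\<^sub>v (transpose_mat A *\<^sub>v x))
      = euclid_norm (center_mat n *\<^sub>v (A *\<^sub>v reverse_vec x))"
    using A by (simp add: transpose_mult_vec_persymmetric center_mat_reverse_vec
        euclid_norm_reverse_vec)
  also have "\<dots> \<le> r * euclid_norm (center_mat n *\<^sub>v reverse_vec x)"
    using r x by (simp add: is_consensus_bound_def)
  also have "\<dots> = r * euclid_norm (center_mat n *\<^sub>v x)"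
    using x by (simp add: center_mat_reverse_vec euclid_norm_reverse_vec)
  finally show "euclid_norm (center_mat n *\<^sub>v (transpose_mat A *\<^sub>v x))
      \<le> r * euclid_norm (center_mat n *\<^sub>v x)" .
qed

text \<open>Below \<open>2 * n\<close> at most one subtraction of \<open>n\<close> is needed, so the
  modulus becomes a linear case split. The case \<open>a = n\<close> belongs to the first branch,
  since the representatives run from 1 to \<open>n\<close>.\<close>

lemma rep_mod_eq:
  assumes "0 < a" "a < 2 * n"
  shows "rep_mod a n = (if a \<le> n then a else a - n)"
proof (cases "a < n")
  case False
  then have "a mod n = (a - n) mod n"
    by (simp add: le_mod_geq)
  with assms False show ?thesis
    by (auto simp: rep_mod_def)
qed (use assms in \<open>simp add: rep_mod_def\<close>)

text \<open>Both tests in \<open>basis_entry\<close> depend only on the difference i - j modulo n,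
  and mirroring (i, j) to (n + 1 - j, n + 1 - i) keeps that difference.\<close>

lemma persymmetric_basis_mat:
  assumes "u < n"
  shows "persymmetric n (basis_mat n u)"
  unfolding persymmetric_def
proof (intro allI impI)
  fix k l assume kl: "k < n" "l < n"
  \<comment> \<open>As \<open>u < n\<close>, both arguments of \<open>rep_mod\<close> lie strictly
    between 0 and \<open>2 * n\<close>, so \<open>rep_mod_eq\<close> leaves only linear
    arithmetic.\<close>
  then have "Suc (n - Suc k) = rep_mod (Suc (n - Suc l) + u) n \<longleftrightarrow> Suc l = rep_mod (Suc k + u) n"
    using assms by (simp add: rep_mod_eq del: less_Suc_eq_le) linarith
  moreover have "Suc (n - Suc k) = Suc (n - Suc l) \<longleftrightarrow> Suc l = Suc k"
    using kl by linarith
  ultimately show "basis_mat n u $$ (n - Suc k, n - Suc l) = basis_mat n u $$ (l, k)"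
    using kl by (simp add: basis_mat_def basis_entry_def)
qed

lemma persymmetric_d_equistatic:
  assumes "\<And>i. i \<in> {1..M} \<Longrightarrow> u i < n"
  shows "persymmetric n (d_equistatic n M u)"
  unfolding persymmetric_def
proof (intro allI impI)
  fix k l assume kl: "k < n" "l < n"
  have "(\<Sum>i=1..M. basis_mat n (u i) $$ (n - Suc k, n - Suc l))
      = (\<Sum>i=1..M. basis_mat n (u i) $$ (l, k))"
    using persymmetric_basis_mat[OF assms] kl
    unfolding persymmetric_def by (intro sum.cong refl) blast
  then show "d_equistatic n M u $$ (n - Suc k, n - Suc l) = d_equistatic n M u $$ (l, k)"
    using kl by (simp add: d_equistatic_def sum_mats_def)
qed

lemma euclid_norm_add_le:
  assumes "v \<in> carrier_vec n" "w \<in> carrier_vec n"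
  shows "euclid_norm (v + w) \<le> euclid_norm v + euclid_norm w"
  using assms L2_set_triangle_ineq[of "\<lambda>i. v $ i" "\<lambda>i. w $ i" "{0..<n}"]
  by (simp add: euclid_norm_def L2_set_def)

lemma euclid_norm_smult: "euclid_norm (c \<cdot>\<^sub>v v) = \<bar>c\<bar> * euclid_norm v"
proof -
  have "euclid_norm (c \<cdot>\<^sub>v v) = sqrt (c\<^sup>2 * (\<Sum>i = 0..<dim_vec v. (v $ i)\<^sup>2))"
    by (simp add: euclid_norm_def L2_set_def power_mult_distrib sum_distrib_left)
  then show ?thesis
    by (simp add: euclid_norm_def L2_set_def real_sqrt_mult)
qed

text \<open>Consensus bounds behave like bounds on an operator seminorm: subadditive here, by
  linearity of centering and the triangle inequality, and absolutely homogeneous in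
  \<open>is_consensus_bound_smult\<close>.\<close>

lemma is_consensus_bound_add:
  assumes A: "A \<in> carrier_mat n n" "is_consensus_bound n A r"
    and B: "B \<in> carrier_mat n n" "is_consensus_bound n B s"
  shows "is_consensus_bound n (A + B) (r + s)"
  unfolding is_consensus_bound_def
proof (intro conjI ballI)
  show "0 \<le> r + s"
    using A B by (simp add: is_consensus_bound_def)
  fix x :: "real vec" assume x: "x \<in> carrier_vec n"
  have "center_mat n *\<^sub>v ((A + B) *\<^sub>v x)
      = center_mat n *\<^sub>v (A *\<^sub>v x) + center_mat n *\<^sub>v (B *\<^sub>v x)"
    using A B x
    by (simp add: add_mult_distrib_mat_vec[of _ n n] mult_add_distrib_mat_vec[of _ n n])
  then have "euclid_norm (center_mat n *\<^sub>v ((A + B) *\<^sub>v x))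
      \<le> euclid_norm (center_mat n *\<^sub>v (A *\<^sub>v x)) + euclid_norm (center_mat n *\<^sub>v (B *\<^sub>v x))"
    by (simp add: euclid_norm_add_le[of _ n] carrier_vecI)
  also have "\<dots> \<le> (r + s) * euclid_norm (center_mat n *\<^sub>v x)"
    using A B x by (simp add: is_consensus_bound_def distrib_right add_mono)
  finally show "euclid_norm (center_mat n *\<^sub>v ((A + B) *\<^sub>v x))
      \<le> (r + s) * euclid_norm (center_mat n *\<^sub>v x)" .
qed

lemma smult_mat_mult_vec:
  fixes A :: "'a :: comm_semiring_0 mat"
  assumes "A \<in> carrier_mat n m" "x \<in> carrier_vec m"
  shows "(c \<cdot>\<^sub>m A) *\<^sub>v x = c \<cdot>\<^sub>v (A *\<^sub>v x)"
  using assms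
  by (intro eq_vecI) (auto simp: scalar_prod_def sum_distrib_left mult.assoc intro!: sum.cong)

lemma is_consensus_bound_smult:
  assumes A: "A \<in> carrier_mat n n" "is_consensus_bound n A r"
  shows "is_consensus_bound n (c \<cdot>\<^sub>m A) (\<bar>c\<bar> * r)"
  unfolding is_consensus_bound_def
proof (intro conjI ballI)
  show "0 \<le> \<bar>c\<bar> * r"
    using A by (simp add: is_consensus_bound_def)
  fix x :: "real vec" assume x: "x \<in> carrier_vec n"
  have "center_mat n *\<^sub>v ((c \<cdot>\<^sub>m A) *\<^sub>v x) = c \<cdot>\<^sub>v (center_mat n *\<^sub>v (A *\<^sub>v x))"
    using A x by (simp add: smult_mat_mult_vec mult_mat_vec[of _ n n])
  then show "euclid_norm (center_mat n *\<^sub>v ((c \<cdot>\<^sub>m A) *\<^sub>v x))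
      \<le> \<bar>c\<bar> * r * euclid_norm (center_mat n *\<^sub>v x)"
    using A x by (simp add: euclid_norm_smult is_consensus_bound_def mult.assoc mult_left_mono)
qed

theorem theorem3:
  fixes n M :: nat and u :: "nat \<Rightarrow> nat" and \<rho> :: real
  assumes "n \<ge> 2" and "M \<ge> 1"
    and "\<forall>i\<in>{1..M}. u i \<in> {1..n - 1}"
    and "\<rho> = consensus_rate n (d_equistatic n M u)"
  shows "\<forall>x\<in>carrier_vec n.
    euclid_norm (center_mat n *\<^sub>v (u_equistatic n M u *\<^sub>v x))
      \<le> \<rho> * euclid_norm (center_mat n *\<^sub>v x)"
proof -
  let ?W = "d_equistatic n M u"
  have "u i < n" if "i \<in> {1..M}" for i
    using that assms(1,3) by fastforce
  then have "persymmetric n ?W"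
    by (rule persymmetric_d_equistatic)
  \<comment> \<open>The rate is defined by \<open>LEAST\<close>, so that \<rho> is itself a bound
    rests on the minimum being attained for these matrices.\<close>
  moreover have W: "is_consensus_bound n ?W \<rho>"
    using d_equistatic_consensus_rate(1)[OF assms(1-3)] assms(4) by simp
  ultimately have "is_consensus_bound n (transpose_mat ?W) \<rho>"
    by (intro is_consensus_bound_transpose) simp_all
  with W have "is_consensus_bound n (?W + transpose_mat ?W) (\<rho> + \<rho>)"
    by (intro is_consensus_bound_add) simp_all
  \<comment> \<open>The factor 1/2 of the symmetrization cancels the doubled rate:
    \<open>\<bar>1 / 2\<bar> * (\<rho> + \<rho>)\<close> is \<rho>.\<close>
  then have "is_consensus_bound n (u_equistatic n M u) (\<bar>1 / 2\<bar> * (\<rho> + \<rho>))"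
    unfolding u_equistatic_def by (intro is_consensus_bound_smult) simp_all
  then show ?thesis
    by (simp add: is_consensus_bound_def)
qed

end
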